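(* Let $\{X_n,n\ge 1\}$ be a sequence of random variables with $\sum_{n=1}^{\infty}\|X_n\|_{\infty}<\infty$. Then: (i) for any $\varepsilon>0$, $$\sum_{n=2}^{\infty}\frac{1}{(\ln n)^{1+\varepsilon}}\left\|\frac{S_n}{n}\right\|_{\infty}<\infty ;$$ (ii) for any $1<q<\infty$, $$\sum_{n=1}^{\infty}E\left[\left|\frac{S_n}{n}\right|^q\right]<\infty ;$$ in particular, $\frac{S_n}{n}$ converges completely to $0$.
   Context: All random variables are real-valued and defined on a common probability space $(\Omega,\mathcal{F},P)$; no independence is assumed. $E$ denotes expectation, $\|X\|_{\infty}$ is the essential supremum of $|X|$, and $S_n=\sum_{k=1}^n X_k$ for $n\ge 1$. A sequence of random variables $\{Y_n,n\ge1\}$ is said to converge completely to a random variable $Y$ if for every $\varepsilon>0$, $\sum_{n=1}^{\infty}P\{|Y_n-Y|\geq\varepsilon\}<\infty$. *)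

theory Defs
  imports "HOL-Probability.Probability"
begin

text \<open>The norm takes values in the extended nonnegative reals; it is infinite for a
  random variable that is not essentially bounded. As the library's \<open>esssup\<close> is infinite on
  non-measurable functions, so is the norm.\<close>

definition Linf_norm :: "'a measure \<Rightarrow> ('a \<Rightarrow> real) \<Rightarrow> ennreal" where
  "Linf_norm M X = esssup M (\<lambda>\<omega>. ennreal \<bar>X \<omega>\<bar>)"

text \<open>Sequences are indexed from 1; the value at index 0 plays no role.\<close>

definition partial_sum :: "(nat \<Rightarrow> 'a \<Rightarrow> real) \<Rightarrow> nat \<Rightarrow> 'a \<Rightarrow> real" where
  "partial_sum X n = (\<lambda>\<omega>. \<Sum>k=1..n. X k \<omega>)"

definition converges_completely ::
  "'a measure \<Rightarrow> (nat \<Rightarrow> 'a \<Rightarrow> real) \<Rightarrow> ('a \<Rightarrow> real) \<Rightarrow> bool" where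
  "converges_completely M Y Z \<longleftrightarrow>
     (\<forall>n\<ge>1. Y n \<in> borel_measurable M) \<and> Z \<in> borel_measurable M \<and>
     (\<forall>\<epsilon>>0. summable (\<lambda>n. measure M {\<omega> \<in> space M. \<bar>Y (Suc n) \<omega> - Z \<omega>\<bar> \<ge> \<epsilon>}))"

end

theory Submission
  imports Defs
begin

text \<open>Let \<open>c\<close> be the finite sum of the norms. The triangle inequality gives |S_n|
  \<le> \<open>c\<close> almost surely with the same \<open>c\<close> for every n
  (\<open>partial_sum_AE_le\<close>), so |S_n / n| \<le> \<open>c\<close> / n almost surely.
  Everything else is comparison with series of reals. For (i), the extra factor 1/n turns the
  logarithmic weight into the convergent Bertrand series 1 / (n (ln n)^p) with p = 1 + \<epsilon>
  (\<open>summable_inverse_mult_ln_powr\<close>). For (ii), the majorant is \<open>c\<close>^q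
  n^(-q) with q > 1. Complete convergence follows directly from the same bound: once
  \<open>c\<close> / n < \<epsilon> the deviation event is null, so only finitely many probabilities
  are nonzero.\<close>

lemma summable_inverse_mult_ln_powr:
  assumes "p > 1"
  shows "summable (\<lambda>n. 1 / (real n * ln (real n) powr p))"
proof -
  define h where "h x = 1 / (x * ln x powr p)" for x :: real
  define f where "f n = h (max 2 (real n))" for n :: nat
    \<comment> \<open>\<open>h\<close> is decreasing only on arguments above 1, so the first two terms are replaced by \<open>h 2\<close>.\<close>
  have f_eq: "f n = h (real n)" if "n \<ge> 2" for n
    using that by (simp add: f_def max_def)
  have h_anti: "h y \<le> h x" if "2 \<le> x" "x \<le> y" for x y
    unfolding h_def using that assms
    by (intro divide_left_mono mult_mono powr_mono2 mult_pos_pos) auto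
  \<comment> \<open>Cauchy condensation: since ln (2^n) = n ln 2, the condensed series is a multiple
    of the p-series. At \<open>n = 0\<close> both sides are 0, as \<open>0 powr p = 0\<close> and
    division by zero yields 0.\<close>
  have h_pow: "2 ^ n * h (real (2 ^ n)) = ln 2 powr (- p) * real n powr (- p)" for n
    by (simp add: h_def ln_realpow powr_mult powr_minus field_simps)
  have "summable (\<lambda>n. real n powr (- p))"
    using assms by (subst summable_real_powr_iff) auto
  then have "summable (\<lambda>n. 2 ^ n * h (real (2 ^ n)))"
    unfolding h_pow by (rule summable_mult)
  moreover have "\<forall>\<^sub>F n in sequentially. 2 ^ n * h (real (2 ^ n)) = 2 ^ n * f (2 ^ n)"
    using eventually_ge_at_top[of 1]
  proof eventually_elim
    case (elim n)
    then have "(2::nat) \<le> 2 ^ n" by (cases n) auto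
    then show ?case by (simp only: f_eq)
  qed
  ultimately have "summable (\<lambda>n. 2 ^ n * f (2 ^ n))"
    by (simp only: summable_cong)
  moreover have "f (Suc m) \<le> f m" "0 \<le> f m" for m
    by (auto simp: f_def intro!: h_anti) (auto simp: h_def)
  ultimately have "summable f"
    by (subst condensation_test) auto
  moreover have "\<forall>\<^sub>F n in sequentially. f n = h (real n)"
    using eventually_ge_at_top[of 2] by eventually_elim (rule f_eq)
  ultimately show ?thesis
    unfolding h_def[symmetric] by (simp only: summable_cong)
qed

lemma Linf_norm_le:
  assumes "f \<in> borel_measurable M" "AE \<omega> in M. \<bar>f \<omega>\<bar> \<le> c"
  shows "Linf_norm M f \<le> ennreal c"
  unfolding Linf_norm_def
proof (rule esssup_I)
  show "(\<lambda>\<omega>. ennreal \<bar>f \<omega>\<bar>) \<in> borel_measurable M"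
    using assms(1) by measurable
  show "AE \<omega> in M. ennreal \<bar>f \<omega>\<bar> \<le> ennreal c"
    using assms(2) by eventually_elim (rule ennreal_leI)
qed

text \<open>Countably many null sets have a null union, so almost surely all terms are bounded by
  their norms at once; the triangle inequality does the rest. The point is that the bound does not
  depend on \<open>n\<close>.\<close>

lemma partial_sum_AE_le:
  fixes X :: "nat \<Rightarrow> 'a \<Rightarrow> real"
  shows "AE \<omega> in M. ennreal \<bar>partial_sum X n \<omega>\<bar> \<le> (\<Sum>k. Linf_norm M (X (k + 1)))"
proof -
  \<comment> \<open>\<open>esssup\<close> is infinite on a non-measurable function, so the bound
    holds at every index, 0 included.\<close>
  have "AE \<omega> in M. \<forall>k. ennreal \<bar>X k \<omega>\<bar> \<le> Linf_norm M (X k)"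
    unfolding AE_all_countable Linf_norm_def by (auto intro: esssup_AE)
  then show ?thesis
  proof eventually_elim
    case (elim \<omega>)
    have "ennreal \<bar>partial_sum X n \<omega>\<bar> \<le> ennreal (\<Sum>k=1..n. \<bar>X k \<omega>\<bar>)"
      unfolding partial_sum_def by (intro ennreal_leI sum_abs)
    also have "\<dots> = (\<Sum>k=1..n. ennreal \<bar>X k \<omega>\<bar>)"
      by simp
    also have "\<dots> \<le> (\<Sum>k=1..n. Linf_norm M (X k))"
      using elim by (intro sum_mono) auto
    also have "\<dots> = (\<Sum>k<n. Linf_norm M (X (k + 1)))"
      by (rule sum.reindex_bij_witness[of _ Suc "\<lambda>k. k - 1"]) auto
    also have "\<dots> \<le> (\<Sum>k. Linf_norm M (X (k + 1)))"
      by (intro sum_le_suminf) auto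
    finally show ?case .
  qed
qed

text \<open>Comparison test across types: finiteness of an extended sum is reduced to summability of
  a real majorant. Both (i) and (ii) end this way.\<close>

lemma suminf_ennreal_less_top:
  assumes "summable g" "\<And>n. 0 \<le> g n" "\<And>n. f n \<le> ennreal (g n)"
  shows "(\<Sum>n. f n) < \<infinity>"
proof -
  have "(\<Sum>n. f n) \<le> (\<Sum>n. ennreal (g n))"
    using assms by (intro suminf_le) auto
  also have "\<dots> = ennreal (\<Sum>n. g n)"
    using assms by (intro suminf_ennreal2) auto
  finally show ?thesis
    by (simp add: le_less_trans)
qed

theorem proposition3p9:
  fixes M :: "'a measure" and X :: "nat \<Rightarrow> 'a \<Rightarrow> real"
  assumes "prob_space M"
    and "\<And>n. n \<ge> 1 \<Longrightarrow> X n \<in> borel_measurable M"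
    and "(\<Sum>n. Linf_norm M (X (n + 1))) < \<infinity>"
  shows "(\<forall>\<epsilon>::real. \<epsilon> > 0 \<longrightarrow>
            (\<Sum>n. ennreal (1 / (ln (real (n + 2))) powr (1 + \<epsilon>)) *
                  Linf_norm M (\<lambda>\<omega>. partial_sum X (n + 2) \<omega> / real (n + 2))) < \<infinity>)
       \<and> (\<forall>q::real. 1 < q \<longrightarrow>
            (\<Sum>n. \<integral>\<^sup>+ \<omega>. ennreal (\<bar>partial_sum X (n + 1) \<omega> / real (n + 1)\<bar> powr q) \<partial>M) < \<infinity>)
       \<and> converges_completely M (\<lambda>n \<omega>. partial_sum X n \<omega> / real n) (\<lambda>\<omega>. 0)"
proof -
  interpret prob_space M by fact
  \<comment> \<open>The total is finite by assumption, so passing to its real value loses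
    nothing.\<close>
  define c where "c = enn2real (\<Sum>n. Linf_norm M (X (n + 1)))"
  have c0: "0 \<le> c" by (simp add: c_def)
  have AE_sum: "AE \<omega> in M. \<bar>partial_sum X n \<omega>\<bar> \<le> c" for n
  proof -
    have "(\<Sum>n. Linf_norm M (X (n + 1))) = ennreal c"
      using assms(3) unfolding c_def by (subst ennreal_enn2real) (simp_all add: less_top)
    with partial_sum_AE_le[of X n M] show ?thesis
      by (simp only: ennreal_le_iff[OF c0])
  qed
  \<comment> \<open>The estimate behind all three claims; at \<open>n = 0\<close> both sides are 0
    by the convention for division.\<close>
  have AE_mean: "AE \<omega> in M. \<bar>partial_sum X n \<omega> / real n\<bar> \<le> c / real n" for n
    using AE_sum[of n] by eventually_elim (simp add: divide_right_mono)
  have meas: "(\<lambda>\<omega>. partial_sum X n \<omega> / real n) \<in> borel_measurable M" for n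
    unfolding partial_sum_def using assms(2) by auto
  have "(\<Sum>n. ennreal (1 / (ln (real (n + 2))) powr (1 + \<epsilon>)) *
           Linf_norm M (\<lambda>\<omega>. partial_sum X (n + 2) \<omega> / real (n + 2))) < \<infinity>"
    if "\<epsilon> > 0" for \<epsilon> :: real
  proof (rule suminf_ennreal_less_top)
    \<comment> \<open>The Bertrand series with its first two terms dropped, scaled by
      \<open>c\<close>.\<close>
    show "summable (\<lambda>n. c * (1 / (real (n + 2) * ln (real (n + 2)) powr (1 + \<epsilon>))))"
      using summable_ignore_initial_segment[OF summable_inverse_mult_ln_powr[of "1 + \<epsilon>"], of 2] that
      by (intro summable_mult) simp
    show "0 \<le> c * (1 / (real (n + 2) * ln (real (n + 2)) powr (1 + \<epsilon>)))" for n
      using c0 by simp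
    show "ennreal (1 / (ln (real (n + 2))) powr (1 + \<epsilon>)) *
        Linf_norm M (\<lambda>\<omega>. partial_sum X (n + 2) \<omega> / real (n + 2))
      \<le> ennreal (c * (1 / (real (n + 2) * ln (real (n + 2)) powr (1 + \<epsilon>))))" for n
    proof -
      have "Linf_norm M (\<lambda>\<omega>. partial_sum X (n + 2) \<omega> / real (n + 2)) \<le> ennreal (c / real (n + 2))"
        by (rule Linf_norm_le[OF meas AE_mean])
      then have "ennreal (1 / (ln (real (n + 2))) powr (1 + \<epsilon>)) *
          Linf_norm M (\<lambda>\<omega>. partial_sum X (n + 2) \<omega> / real (n + 2))
        \<le> ennreal (1 / (ln (real (n + 2))) powr (1 + \<epsilon>)) * ennreal (c / real (n + 2))"
        by (rule mult_left_mono) simp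
      also have "\<dots> = ennreal (c * (1 / (real (n + 2) * ln (real (n + 2)) powr (1 + \<epsilon>))))"
        using c0 by (subst ennreal_mult[symmetric]) (auto simp: mult.commute)
      finally show ?thesis .
    qed
  qed
  moreover have "(\<Sum>n. \<integral>\<^sup>+ \<omega>. ennreal (\<bar>partial_sum X (n + 1) \<omega> / real (n + 1)\<bar> powr q) \<partial>M) < \<infinity>"
    if "1 < q" for q :: real
  proof (rule suminf_ennreal_less_top)
    have "summable (\<lambda>n. real n powr (- q))"
      using that by (subst summable_real_powr_iff) auto
    from summable_ignore_initial_segment[OF this, of 1]
    show "summable (\<lambda>n. c powr q * real (n + 1) powr (- q))"
      by (intro summable_mult)
    show "0 \<le> c powr q * real (n + 1) powr (- q)" for n
      by simp
    show "(\<integral>\<^sup>+ \<omega>. ennreal (\<bar>partial_sum X (n + 1) \<omega> / real (n + 1)\<bar> powr q) \<partial>M)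
      \<le> ennreal (c powr q * real (n + 1) powr (- q))" for n
    proof -
      have "(\<integral>\<^sup>+ \<omega>. ennreal (\<bar>partial_sum X (n + 1) \<omega> / real (n + 1)\<bar> powr q) \<partial>M)
        \<le> (\<integral>\<^sup>+ \<omega>. ennreal ((c / real (n + 1)) powr q) \<partial>M)"
        by (rule nn_integral_mono_AE, rule eventually_mono[OF AE_mean[of "n + 1"]])
          (use that in \<open>auto intro!: ennreal_leI powr_mono2\<close>)
      \<comment> \<open>The integrand is constant and the space has total mass 1.\<close>
      also have "\<dots> = ennreal (c powr q * real (n + 1) powr (- q))"
        using c0 by (simp add: emeasure_space_1 powr_divide powr_minus_divide)
      finally show ?thesis .
    qed
  qed
  moreover have "converges_completely M (\<lambda>n \<omega>. partial_sum X n \<omega> / real n) (\<lambda>\<omega>. 0)"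
    unfolding converges_completely_def
  proof (intro conjI allI impI)
    fix \<epsilon> :: real assume "\<epsilon> > 0"
    show "summable (\<lambda>n. measure M {\<omega> \<in> space M.
      \<bar>partial_sum X (Suc n) \<omega> / real (Suc n) - 0\<bar> \<ge> \<epsilon>})"
    \<comment> \<open>For n beyond \<open>c / \<epsilon>\<close> the almost sure bound
      \<open>c / real (Suc n)\<close> lies strictly below \<open>\<epsilon>\<close>, so the event
      has probability 0 and the series is a finite sum.\<close>
    proof (rule summable_finite)
      show "finite {..nat \<lceil>c / \<epsilon>\<rceil>}" by simp
      fix n assume "n \<notin> {..nat \<lceil>c / \<epsilon>\<rceil>}"
      then have "c / \<epsilon> < real (Suc n)" by (auto simp: not_le) linarith
      then have "c / real (Suc n) < \<epsilon>"
        using \<open>\<epsilon> > 0\<close> by (simp add: field_simps)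
      then have "AE \<omega> in M. \<not> \<epsilon> \<le> \<bar>partial_sum X (Suc n) \<omega> / real (Suc n) - 0\<bar>"
        using AE_mean[of "Suc n"] by (auto elim: eventually_mono)
      moreover have "{\<omega> \<in> space M. \<epsilon> \<le> \<bar>partial_sum X (Suc n) \<omega> / real (Suc n) - 0\<bar>} \<in> sets M"
        using meas[of "Suc n"] by measurable
      ultimately show "measure M {\<omega> \<in> space M. \<bar>partial_sum X (Suc n) \<omega> / real (Suc n) - 0\<bar> \<ge> \<epsilon>} = 0"
        by (subst prob_eq_0) auto
    qed
  qed (use meas in auto)
  ultimately show ?thesis by blast
qed

end
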